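(* Let $\mathbf A=(A,R)$ be a directed relational system with $R$ reflexive, let $a\in A$, let $(A^2,S,{}^* )$ be the twist-product of $\mathbf A$, and let $T:=S\cap(P_a(\mathbf A))^2$. Then the following hold: (i) If $R$ is transitive then $(P_a(\mathbf A),T,{}^* )$ (with $^*$ restricted to $P_a(\mathbf A)$) is a directed relational system with involution which is a Kleene relational system. (ii) The mapping $x\mapsto(x,a)$ is an embedding of $\mathbf A$ into $(P_a(\mathbf A),T)$.
   Context: For a binary relation $R$ on a non-empty set $A$ and $a,b\in A$, let $U(a,b):=\{x\in A\mid (a,x),(b,x)\in R\}$ and $L(a,b):=\{x\in A\mid (x,a),(x,b)\in R\}$ (cones with respect to $R$). The relational system $(A,R)$ ($A\neq\emptyset$) is directed if $U(x,y)\neq\emptyset$ and $L(x,y)\neq\emptyset$ for all $x,y\in A$. A unary operation $'$ on $A$ is an (antitone) involution on $(A,R)$ if $x''=x$ for all $x\in A$ and $(x,y)\in R$ implies $(y',x')\in R$ for all $x,y\in A$. A directed relational system with involution is a triple $(A,R,{}')$ where $R$ is reflexive, $(A,R)$ is directed and $'$ is an involution on $(A,R)$. For subsets $B,C\subseteq A$ and $c\in A$, write $(B,C)\in R$ if $B\times C\subseteq R$; $(c,C)\in R$ and $(B,c)\in R$ abbreviate $(\{c\},C)\in R$ and $(B,\{c\})\in R$. A Kleene relational system is a relational system $(A,R,{}')$ with an antitone involution satisfying $(L(x,x'),U(y,y'))\in R$ for all $x,y\in A$ (cones taken in the system itself). The twist-product of $(A,R)$ is $(A^2,S,{}^* )$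 where $S:=\{((x,y),(z,v))\in(A^2)^2\mid (x,z),(v,y)\in R\}$ and $(x,y)^*:=(y,x)$. For $a\in A$, $P_a(\mathbf A):=\{(x,y)\in A^2\mid (L(x,y),a)\in R\text{ and }(a,U(x,y))\in R\}$, with cones taken with respect to $R$. An embedding of $(A,R)$ into $(B,S)$ is an injective map $f:A\to B$ such that for all $x,y\in A$, $(x,y)\in R$ if and only if $(f(x),f(y))\in S$. *)

theory Defs
  imports Main
begin

definition relational_system :: "'a set \<Rightarrow> 'a rel \<Rightarrow> bool" where
  "relational_system A R \<longleftrightarrow> A \<noteq> {} \<and> R \<subseteq> A \<times> A"

definition upper_cone :: "'a set \<Rightarrow> 'a rel \<Rightarrow> 'a \<Rightarrow> 'a \<Rightarrow> 'a set" where
  "upper_cone A R a b = {x \<in> A. (a, x) \<in> R \<and> (b, x) \<in> R}"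

definition lower_cone :: "'a set \<Rightarrow> 'a rel \<Rightarrow> 'a \<Rightarrow> 'a \<Rightarrow> 'a set" where
  "lower_cone A R a b = {x \<in> A. (x, a) \<in> R \<and> (x, b) \<in> R}"

definition directed_system :: "'a set \<Rightarrow> 'a rel \<Rightarrow> bool" where
  "directed_system A R \<longleftrightarrow> relational_system A R \<and>
     (\<forall>x\<in>A. \<forall>y\<in>A. upper_cone A R x y \<noteq> {} \<and> lower_cone A R x y \<noteq> {})"

text \<open>An operation on the carrier is a total function on the ambient type that maps the carrier
  into itself; its values outside the carrier are irrelevant, so restricting an operation to
  a subset needs no change of the function.\<close>

definition involution_on :: "'a set \<Rightarrow> 'a rel \<Rightarrow> ('a \<Rightarrow> 'a) \<Rightarrow> bool" where
  "involution_on A R f \<longleftrightarrow> f ` A \<subseteq> A \<and> (\<forall>x\<in>A. f (f x) = x) \<and>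
     (\<forall>x\<in>A. \<forall>y\<in>A. (x, y) \<in> R \<longrightarrow> (f y, f x) \<in> R)"

definition directed_system_with_involution :: "'a set \<Rightarrow> 'a rel \<Rightarrow> ('a \<Rightarrow> 'a) \<Rightarrow> bool" where
  "directed_system_with_involution A R f \<longleftrightarrow>
     refl_on A R \<and> directed_system A R \<and> involution_on A R f"

text \<open>The paper's \<open>(B, C) \<in> R\<close> for sets \<open>B\<close>, \<open>C\<close> is rendered as \<open>B \<times> C \<subseteq> R\<close>.\<close>

definition kleene_relational_system :: "'a set \<Rightarrow> 'a rel \<Rightarrow> ('a \<Rightarrow> 'a) \<Rightarrow> bool" where
  "kleene_relational_system A R f \<longleftrightarrow> relational_system A R \<and> involution_on A R f \<and>
     (\<forall>x\<in>A. \<forall>y\<in>A. lower_cone A R x (f x) \<times> upper_cone A R y (f y) \<subseteq> R)"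

text \<open>The twist-product of \<open>(A, R)\<close> has carrier \<open>A \<times> A\<close>, the relation below, and the
  involution \<^const>\<open>prod.swap\<close>.\<close>

definition twist_rel :: "'a set \<Rightarrow> 'a rel \<Rightarrow> ('a \<times> 'a) rel" where
  "twist_rel A R = {((x, y), (z, v)) | x y z v.
     x \<in> A \<and> y \<in> A \<and> z \<in> A \<and> v \<in> A \<and> (x, z) \<in> R \<and> (v, y) \<in> R}"

definition twist_part :: "'a set \<Rightarrow> 'a rel \<Rightarrow> 'a \<Rightarrow> ('a \<times> 'a) set" where
  "twist_part A R a = {(x, y). x \<in> A \<and> y \<in> A \<and>
     lower_cone A R x y \<times> {a} \<subseteq> R \<and> {a} \<times> upper_cone A R x y \<subseteq> R}"

definition embedding :: "'a set \<Rightarrow> 'a rel \<Rightarrow> 'b set \<Rightarrow> 'b rel \<Rightarrow> ('a \<Rightarrow> 'b) \<Rightarrow> bool" where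
  "embedding A R B S f \<longleftrightarrow> relational_system A R \<and> relational_system B S \<and>
     f ` A \<subseteq> B \<and> inj_on f A \<and> (\<forall>x\<in>A. \<forall>y\<in>A. (x, y) \<in> R \<longleftrightarrow> (f x, f y) \<in> S)"

end

theory Submission
  imports Defs
begin

text \<open>
  For transitive \<open>R\<close> everything rests on the pairs \<open>(p, q)\<close> with \<open>p\<close> below \<open>a\<close> and \<open>a\<close> below
  \<open>q\<close>, and on their images under \<open>swap\<close>. All of them lie in \<open>P = twist_part A R a\<close>
  (\<open>mem_twist_part_if_separated\<close>).

  A common upper bound in \<open>P\<close> of \<open>(x, y)\<close> and \<open>(z, v)\<close> is a pair \<open>(u, w)\<close> whose first component
  lies above \<open>x\<close>, \<open>z\<close> and \<open>a\<close> and whose second component lies below \<open>y\<close>, \<open>v\<close> and \<open>a\<close>;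
  directedness of \<open>A\<close>, used twice per component, supplies both. Lower bounds follow by applying
  \<open>swap\<close>, which is an antitone involution of \<open>P\<close>.

  For the Kleene condition, a pair \<open>(p, q)\<close> below both \<open>(x, y)\<close> and \<open>(y, x)\<close> has \<open>p\<close> in the lower
  cone and \<open>q\<close> in the upper cone of \<open>x\<close> and \<open>y\<close>. Membership of \<open>(x, y)\<close> in \<open>P\<close> says exactly that
  \<open>a\<close> separates these cones, so \<open>p\<close> is below \<open>a\<close> and \<open>a\<close> is below \<open>q\<close>. Dually, a pair above both
  some element of \<open>P\<close> and its swap has its first component above and its second component below
  \<open>a\<close>. Transitivity through \<open>a\<close> then compares the two pairs. Put differently, \<open>(a, a)\<close> lies between
  the two cones of the Kleene condition.

  The embedding rests on reflexivity at \<open>a\<close>, which makes the second components of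
  \<open>(x, a)\<close> and \<open>(y, a)\<close> comparable in either direction, and every element of a cone of \<open>x\<close> and \<open>a\<close>
  is comparable with \<open>a\<close> by definition.
\<close>

lemma twist_rel_iff:
  assumes "R \<subseteq> A \<times> A"
  shows "((x, y), (z, v)) \<in> twist_rel A R \<longleftrightarrow> (x, z) \<in> R \<and> (v, y) \<in> R"
  using assms unfolding twist_rel_def by auto

lemma twist_part_iff:
  assumes "R \<subseteq> A \<times> A"
  shows "(x, y) \<in> twist_part A R a \<longleftrightarrow> x \<in> A \<and> y \<in> A \<and>
    (\<forall>p. (p, x) \<in> R \<longrightarrow> (p, y) \<in> R \<longrightarrow> (p, a) \<in> R) \<and>
    (\<forall>q. (x, q) \<in> R \<longrightarrow> (y, q) \<in> R \<longrightarrow> (a, q) \<in> R)"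
  using assms unfolding twist_part_def lower_cone_def upper_cone_def by auto

lemma swap_mem_twist_part:
  "x \<in> twist_part A R a \<Longrightarrow> prod.swap x \<in> twist_part A R a"
  unfolding twist_part_def lower_cone_def upper_cone_def by (cases x) auto

text \<open>Anything below \<open>w\<close> is below \<open>a\<close> and anything above \<open>u\<close> is above \<open>a\<close>, so each cone
  condition already follows from one of the two components.\<close>

lemma mem_twist_part_if_separated:
  assumes "R \<subseteq> A \<times> A" "trans R" "(a, u) \<in> R" "(w, a) \<in> R"
  shows "(u, w) \<in> twist_part A R a"
  using assms(1,3,4) transD[OF assms(2)] unfolding twist_part_iff[OF assms(1)] by blast

lemma directed_above_three:
  assumes "directed_system A R" "trans R" "x \<in> A" "y \<in> A" "z \<in> A"
  obtains u where "(x, u) \<in> R" "(y, u) \<in> R" "(z, u) \<in> R"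
proof -
  obtain t where t: "t \<in> A" "(x, t) \<in> R" "(y, t) \<in> R"
    using assms unfolding directed_system_def upper_cone_def by blast
  obtain u where "(t, u) \<in> R" "(z, u) \<in> R"
    using assms t(1) unfolding directed_system_def upper_cone_def by blast
  with t that transD[OF \<open>trans R\<close>] show thesis by blast
qed

lemma directed_below_three:
  assumes "directed_system A R" "trans R" "x \<in> A" "y \<in> A" "z \<in> A"
  obtains u where "(u, x) \<in> R" "(u, y) \<in> R" "(u, z) \<in> R"
proof -
  obtain t where t: "t \<in> A" "(t, x) \<in> R" "(t, y) \<in> R"
    using assms unfolding directed_system_def lower_cone_def by blast
  obtain u where "(u, t) \<in> R" "(u, z) \<in> R"
    using assms t(1) unfolding directed_system_def lower_cone_def by blast
  with t that transD[OF \<open>trans R\<close>] show thesis by blast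
qed

lemma involution_on_twist_part:
  fixes A :: "'a set" and R :: "'a rel" and a :: 'a
  defines "P \<equiv> twist_part A R a"
  shows "involution_on P (twist_rel A R \<inter> (P \<times> P)) prod.swap"
proof -
  have "(prod.swap y, prod.swap x) \<in> twist_rel A R" if "(x, y) \<in> twist_rel A R" for x y
    using that unfolding twist_rel_def by auto
  then show ?thesis
    unfolding involution_on_def P_def using swap_mem_twist_part by fastforce
qed

text \<open>A pair that merely bounds \<open>p\<close> and \<open>q\<close> in the twist-product need not lie in
  \<open>twist_part\<close>. Placing its components on opposite sides of \<open>a\<close> as well puts it there.\<close>

lemma twist_part_upper_bound:
  assumes "directed_system A R" "trans R" "a \<in> A"
    and "p \<in> twist_part A R a" "q \<in> twist_part A R a"
  obtains r where "r \<in> twist_part A R a" "(p, r) \<in> twist_rel A R" "(q, r) \<in> twist_rel A R"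
proof -
  have R: "R \<subseteq> A \<times> A"
    using assms(1) unfolding directed_system_def relational_system_def by blast
  obtain x y z v where pq: "p = (x, y)" "q = (z, v)" by (cases p, cases q)
  then have mem: "x \<in> A" "y \<in> A" "z \<in> A" "v \<in> A"
    using assms(4,5) by (auto simp: twist_part_iff[OF R])
  obtain u where u: "(x, u) \<in> R" "(z, u) \<in> R" "(a, u) \<in> R"
    using directed_above_three[OF assms(1,2) mem(1,3) assms(3)] by blast
  obtain w where w: "(w, y) \<in> R" "(w, v) \<in> R" "(w, a) \<in> R"
    using directed_below_three[OF assms(1,2) mem(2,4) assms(3)] by blast
  show thesis
    using that[of "(u, w)"] mem_twist_part_if_separated[OF R assms(2) u(3) w(3)] u w
    by (simp add: pq twist_rel_iff[OF R])
qed

lemma mem_twist_part_with_base: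
  assumes "R \<subseteq> A \<times> A" "x \<in> A" "a \<in> A"
  shows "(x, a) \<in> twist_part A R a"
  using assms by (simp add: twist_part_iff)

lemma directed_twist_part:
  fixes A :: "'a set" and R :: "'a rel" and a :: 'a
  assumes dir: "directed_system A R" and tr: "trans R" and a: "a \<in> A"
  defines "P \<equiv> twist_part A R a"
  shows "directed_system P (twist_rel A R \<inter> (P \<times> P))"
proof -
  let ?T = "twist_rel A R \<inter> (P \<times> P)"
  have R: "R \<subseteq> A \<times> A"
    using dir unfolding directed_system_def relational_system_def by blast
  have "(a, a) \<in> P"
    unfolding P_def by (rule mem_twist_part_with_base[OF R a a])
  then have sys: "relational_system P ?T"
    unfolding relational_system_def by blast
  have up: "\<exists>r\<in>P. (p, r) \<in> ?T \<and> (q, r) \<in> ?T" if "p \<in> P" "q \<in> P" for p q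
    using twist_part_upper_bound[OF dir tr a] that unfolding P_def by (metis IntI SigmaI)
  \<comment> \<open>Swapping turns an upper bound of the swapped pairs into a lower bound of the pairs.\<close>
  have low: "\<exists>r\<in>P. (r, p) \<in> ?T \<and> (r, q) \<in> ?T" if "p \<in> P" "q \<in> P" for p q
  proof -
    have inv: "involution_on P ?T prod.swap"
      unfolding P_def by (rule involution_on_twist_part)
    then have sw: "prod.swap p \<in> P" "prod.swap q \<in> P"
      using that unfolding involution_on_def by blast+
    then obtain r where r: "r \<in> P" "(prod.swap p, r) \<in> ?T" "(prod.swap q, r) \<in> ?T"
      using up by blast
    with sw inv have "prod.swap r \<in> P"
        "(prod.swap r, prod.swap (prod.swap p)) \<in> ?T" "(prod.swap r, prod.swap (prod.swap q)) \<in> ?T"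
      unfolding involution_on_def by blast+
    then show ?thesis by auto
  qed
  have "upper_cone P ?T p q \<noteq> {}" "lower_cone P ?T p q \<noteq> {}" if "p \<in> P" "q \<in> P" for p q
    using up[OF that] low[OF that] unfolding upper_cone_def lower_cone_def by blast+
  with sys show ?thesis
    unfolding directed_system_def by blast
qed

text \<open>A pair \<open>(p, q)\<close> below \<open>(x, y)\<close> and below its swap has \<open>p\<close> in the lower cone and \<open>q\<close> in
  the upper cone of \<open>x\<close> and \<open>y\<close>, which are the cones that the definition of \<open>twist_part\<close>
  compares with \<open>a\<close>.\<close>

lemma separated_if_below_swap_pair:
  assumes "R \<subseteq> A \<times> A" "(x, y) \<in> twist_part A R a"
    and "((p, q), (x, y)) \<in> twist_rel A R" "((p, q), (y, x)) \<in> twist_rel A R"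
  shows "(p, a) \<in> R" "(a, q) \<in> R"
  using assms by (auto simp: twist_part_iff twist_rel_iff)

lemma separated_if_above_swap_pair:
  assumes "R \<subseteq> A \<times> A" "(x, y) \<in> twist_part A R a"
    and "((x, y), (p, q)) \<in> twist_rel A R" "((y, x), (p, q)) \<in> twist_rel A R"
  shows "(a, p) \<in> R" "(q, a) \<in> R"
  using assms by (auto simp: twist_part_iff twist_rel_iff)

text \<open>Elements of the two cones of the Kleene condition lie on opposite sides of \<open>(a, a)\<close>, so
  they are comparable through it, whatever pairs of \<open>P\<close> the cones come from.\<close>

lemma kleene_twist_part:
  fixes A :: "'a set" and R :: "'a rel" and a :: 'a
  assumes R: "R \<subseteq> A \<times> A" and tr: "trans R" and a: "a \<in> A"
  defines "P \<equiv> twist_part A R a"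
  shows "kleene_relational_system P (twist_rel A R \<inter> (P \<times> P)) prod.swap"
proof -
  let ?T = "twist_rel A R \<inter> (P \<times> P)"
  have "(a, a) \<in> P"
    unfolding P_def by (rule mem_twist_part_with_base[OF R a a])
  then have sys: "relational_system P ?T"
    unfolding relational_system_def by blast
  have "(l, u) \<in> ?T"
    if x: "x \<in> P" and y: "y \<in> P"
      and l: "l \<in> lower_cone P ?T x (prod.swap x)" and u: "u \<in> upper_cone P ?T y (prod.swap y)"
    for x y l u
  proof -
    obtain x1 x2 y1 y2 p q r s where
      eq: "x = (x1, x2)" "y = (y1, y2)" "l = (p, q)" "u = (r, s)"
      by (cases x, cases y, cases l, cases u)
    have "(p, a) \<in> R" "(a, q) \<in> R"
      using separated_if_below_swap_pair[OF R, of x1 x2 a p q] x l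
      by (auto simp: eq P_def lower_cone_def)
    moreover have "(a, r) \<in> R" "(s, a) \<in> R"
      using separated_if_above_swap_pair[OF R, of y1 y2 a r s] y u
      by (auto simp: eq P_def upper_cone_def)
    ultimately have "(p, r) \<in> R" "(s, q) \<in> R"
      using transD[OF tr] by blast+
    then show ?thesis
      using l u by (simp add: eq twist_rel_iff[OF R] lower_cone_def upper_cone_def)
  qed
  then have "lower_cone P ?T x (prod.swap x) \<times> upper_cone P ?T y (prod.swap y) \<subseteq> ?T"
    if "x \<in> P" "y \<in> P" for x y
    using that by (meson SigmaE2 subrelI)
  then show ?thesis
    using sys involution_on_twist_part[of A R a]
    unfolding kleene_relational_system_def P_def by blast
qed

text \<open>The second component being constant, order reflection and preservation reduce to the first
  component and \<open>(a, a) \<in> R\<close>.\<close>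

lemma embedding_twist_part:
  fixes A :: "'a set" and R :: "'a rel" and a :: 'a
  assumes sys: "relational_system A R" and refl: "(a, a) \<in> R"
  defines "P \<equiv> twist_part A R a"
  shows "embedding A R P (twist_rel A R \<inter> (P \<times> P)) (\<lambda>x. (x, a))"
proof -
  have R: "R \<subseteq> A \<times> A"
    using sys unfolding relational_system_def by blast
  with refl have a: "a \<in> A" by blast
  have mem: "(x, a) \<in> P" if "x \<in> A" for x
    unfolding P_def by (rule mem_twist_part_with_base[OF R that a])
  have "relational_system P (twist_rel A R \<inter> (P \<times> P))"
    using mem[OF a] unfolding relational_system_def by blast
  then show ?thesis
    unfolding embedding_def using sys mem refl
    by (auto simp: inj_on_def twist_rel_iff[OF R])
qed

theorem theorem5p7:
  fixes A :: "'a set" and R :: "'a rel" and a :: 'a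
    and P :: "('a \<times> 'a) set" and T :: "('a \<times> 'a) rel"
  assumes "directed_system A R" and "refl_on A R" and "a \<in> A"
  defines "P \<equiv> twist_part A R a"
  defines "T \<equiv> twist_rel A R \<inter> (P \<times> P)"
  shows "(trans R \<longrightarrow> directed_system_with_involution P T prod.swap \<and>
                     kleene_relational_system P T prod.swap) \<and>
         embedding A R P T (\<lambda>x. (x, a))"
proof -
  have sys: "relational_system A R"
    using assms(1) unfolding directed_system_def by blast
  then have R: "R \<subseteq> A \<times> A"
    unfolding relational_system_def by blast
  have rfl: "(x, x) \<in> R" if "x \<in> A" for x
    using assms(2) that by (rule refl_onD)
  have "refl_on P T"
    unfolding T_def P_def refl_on_def by (auto simp: twist_rel_iff[OF R] twist_part_iff[OF R] rfl)
  then have "directed_system_with_involution P T prod.swap" if "trans R"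
    using directed_twist_part[OF assms(1) that assms(3)] involution_on_twist_part[of A R a]
    unfolding directed_system_with_involution_def T_def P_def by simp
  moreover have "kleene_relational_system P T prod.swap" if "trans R"
    unfolding T_def P_def by (rule kleene_twist_part[OF R that assms(3)])
  moreover have "embedding A R P T (\<lambda>x. (x, a))"
    unfolding T_def P_def by (rule embedding_twist_part[OF sys rfl[OF assms(3)]])
  ultimately show ?thesis by blast
qed

end
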